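(* Let $(X,\circ_0,\dots,\circ_{n-1})$ be a finite strict globular $n$-category, satisfying either the usual exchange property or the non-commutative exchange property, and let $(A,\cdot)$ be an associative unital algebra. Let $T^\bullet(A)=X\times A$ be the constant bundle over $X$ with fibre $A$, and $\Gamma(X;T^\bullet(A))$ its family of sections (i.e. the functions $\sigma:X\to A$, $x\mapsto\sigma_x$). (1) For every $p=0,\dots,n-1$, $\Gamma(X;T^\bullet(A))$ is a unital associative algebra with respect to the convolution $$(\sigma\,\hat\circ_p\,\rho)_z:=\sum_{x\circ_p y=z}\sigma_x\cdot\rho_y,\qquad \sigma,\rho\in\Gamma(X;T^\bullet(A)),\ z\in X.$$ (2) The bundle $T^\bullet(A)$ embeds into $\Gamma(X;T^\bullet(A))$ via the fibrewise linear maps $a_x\mapsto a\cdot\delta^x$ ($a\in A$, $x\in X$), where $(\delta^x)_y=1_A$ if $x=y$ and $(\delta^x)_y=0_A$ if $x\neq y$; and, with the restrictions of the convolution operations $\hat\circ_0,\dots,\hat\circ_{n-1}$, it becomes a strict globular $n$-category. (3) Whenever the algebra $A$ fails to be commutative, the resulting $n$-category $(T^\bullet(A),\hat\circ_0,\dots,\hat\circ_{n-1})$ does not satisfy the usual exchange property (even when $X$ does), but it satisfies the non-commutative exchange property.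
   Context: A 1-category (arrows-only form) $(C,\circ)$ is a class $C$ with a partially defined binary operation $\circ$ such that: if one of $f\circ(g\circ h)$, $(f\circ g)\circ h$ exists so does the other and they are equal; for every $f$ there are a right-composable $r$ and a left-composable $l$ that are partial identities (an element $e$ is a partial identity if $h\circ e=h$ and $e\circ h=h$ whenever these compositions exist); if some right identity of $f$ is also a left identity of $g$, then $f\circ g$ exists. A functor is a map preserving existing compositions (if $x\circ y$ exists then $\phi(x)\circ\phi(y)$ exists and equals $\phi(x\circ y)$) and sending partial identities to partial identities. A (strict globular) $n$-category $(C,\circ_0,\dots,\circ_{n-1})$ is a class with $n$ partial binary operations such that: each $(C,\circ_p)$ is a 1-category, with class of partial identities denoted $C^p$ (and $C^n:=C$); $C^q\subset C^p$ for $q<p$; for $q<p$ the $\circ_q$-composition of $\circ_p$-identities, whenever it exists, is a $\circ_p$-identity; and one of the following exchange properties holds. Usual exchange: for all $q<p$, whenever $(x\circ_p y)\circ_q(w\circ_p z)$ exists, also $(x\circ_q w)\circ_p(y\circ_q z)$ exists and they coincide. Non-commutative exchange: for every $\circ_p$-identity $\iota$ and every $q<p$, the partially defined maps $\iota\circ_q-$ and $-\circ_q\iota$ from $(C,\circ_p)$ to $(C,\circ_p)$ are functorial (they preserve existing $\circ_p$-compositions and $\circ_p$-identities). An element of the fibre of $T^\bullet(A)=X\times A$ over $x\in X$ is written $a_x:=(a,x)$. The restriction of $\hat\circ_p$ to $T^\bullet(A)$ is the partial operation defined for $a_x,b_y$ exactly when $x\circ_p y$ exists in $X$, in which case $a_x\,\hat\circ_p\,b_y=(a\cdot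 b)_{x\circ_p y}$.
   Formalization: In (3), the failure of the usual exchange property is asserted only for n ≥ 2 and X nonempty; for n ≤ 1 or X empty that property holds vacuously, so the claim as written is false there. *)

theory Defs
  imports "HOL-Algebra.Module" "HOL-Library.FuncSet"
begin

section \<open>Arrows-only categories\<close>

text \<open>A partial binary operation on a carrier \<open>C\<close> is a function into \<open>option\<close>; \<open>None\<close> means that
  the composition does not exist. Values of the operation outside \<open>C\<close> are irrelevant.\<close>

type_synonym 'x pop = "'x \<Rightarrow> 'x \<Rightarrow> 'x option"

definition partial_ids :: "'x set \<Rightarrow> 'x pop \<Rightarrow> 'x set" where
  "partial_ids C c = {e \<in> C. \<forall>h\<in>C. (\<forall>k. c h e = Some k \<longrightarrow> k = h) \<and> (\<forall>k. c e h = Some k \<longrightarrow> k = h)}"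

text \<open>In \<open>assoc\<close>, equality in \<open>option\<close> says that if one side exists then so does the other and they
  are equal.\<close>

locale one_category =
  fixes C :: "'x set" and c :: "'x pop"
  assumes closed: "\<lbrakk>f \<in> C; g \<in> C; c f g = Some h\<rbrakk> \<Longrightarrow> h \<in> C"
    and assoc: "\<lbrakk>f \<in> C; g \<in> C; h \<in> C\<rbrakk> \<Longrightarrow>
      Option.bind (c g h) (\<lambda>k. c f k) = Option.bind (c f g) (\<lambda>k. c k h)"
    and right_id: "f \<in> C \<Longrightarrow> \<exists>r \<in> partial_ids C c. c f r \<noteq> None"
    and left_id: "f \<in> C \<Longrightarrow> \<exists>l \<in> partial_ids C c. c l f \<noteq> None"
    and comp_exists: "\<lbrakk>f \<in> C; g \<in> C; e \<in> partial_ids C c; c f e \<noteq> None; c e g \<noteq> None\<rbrakk> \<Longrightarrow>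
      c f g \<noteq> None"

text \<open>Functoriality of a partially defined map \<open>\<phi>\<close> from \<open>(C, c)\<close> to itself. For an existing
  composition \<open>z\<close> of \<open>x\<close> and \<open>y\<close>, the map is defined at \<open>z\<close> iff it is defined at both \<open>x\<close> and \<open>y\<close>,
  and then it preserves the composition. Applied to the maps given by \<open>\<circ>\<^sub>q\<close>-composition with a
  \<open>\<circ>\<^sub>p\<close>-identity, this agrees with the existence convention of the usual exchange property (of which
  it is the special case \<open>x = y = \<iota>\<close> or \<open>w = z = \<iota>\<close>), and it forces \<open>\<circ>\<^sub>p\<close>-composable elements to have the
  same \<open>\<circ>\<^sub>q\<close>-sources and \<open>\<circ>\<^sub>q\<close>-targets, i.e. globularity.\<close>

definition partial_functor :: "'x set \<Rightarrow> 'x pop \<Rightarrow> ('x \<Rightarrow> 'x option) \<Rightarrow> bool" where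
  "partial_functor C c \<phi> \<longleftrightarrow>
    (\<forall>x\<in>C. \<forall>y\<in>C. \<forall>z. c x y = Some z \<longrightarrow> \<phi> z \<noteq> None \<or> (\<phi> x \<noteq> None \<and> \<phi> y \<noteq> None) \<longrightarrow>
      (\<exists>x' y' z'. \<phi> x = Some x' \<and> \<phi> y = Some y' \<and> \<phi> z = Some z' \<and> c x' y' = Some z')) \<and>
    (\<forall>e\<in>partial_ids C c. \<forall>e'. \<phi> e = Some e' \<longrightarrow> e' \<in> partial_ids C c)"


section \<open>Strict globular \<open>n\<close>-categories\<close>

text \<open>The operations are \<open>c 0, \<dots>, c (n - 1)\<close>; \<open>c p\<close> is irrelevant for \<open>p \<ge> n\<close>.\<close>

definition usual_exchange :: "nat \<Rightarrow> 'x set \<Rightarrow> (nat \<Rightarrow> 'x pop) \<Rightarrow> bool" where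
  "usual_exchange n C c \<longleftrightarrow>
    (\<forall>p q. q < p \<longrightarrow> p < n \<longrightarrow>
      (\<forall>x\<in>C. \<forall>y\<in>C. \<forall>w\<in>C. \<forall>z\<in>C. \<forall>a b u.
        c p x y = Some a \<longrightarrow> c p w z = Some b \<longrightarrow> c q a b = Some u \<longrightarrow>
        (\<exists>d e. c q x w = Some d \<and> c q y z = Some e \<and> c p d e = Some u)))"

definition noncommutative_exchange :: "nat \<Rightarrow> 'x set \<Rightarrow> (nat \<Rightarrow> 'x pop) \<Rightarrow> bool" where
  "noncommutative_exchange n C c \<longleftrightarrow>
    (\<forall>p q. q < p \<longrightarrow> p < n \<longrightarrow>
      (\<forall>\<iota>\<in>partial_ids C (c p).
        partial_functor C (c p) (\<lambda>x. c q \<iota> x) \<and> partial_functor C (c p) (\<lambda>x. c q x \<iota>)))"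

locale strict_n_category =
  fixes n :: nat and C :: "'x set" and c :: "nat \<Rightarrow> 'x pop"
  assumes one_cat: "p < n \<Longrightarrow> one_category C (c p)"
    and ids_mono: "\<lbrakk>q < p; p < n\<rbrakk> \<Longrightarrow> partial_ids C (c q) \<subseteq> partial_ids C (c p)"
    and ids_comp: "\<lbrakk>q < p; p < n; e \<in> partial_ids C (c p); f \<in> partial_ids C (c p);
      c q e f = Some g\<rbrakk> \<Longrightarrow> g \<in> partial_ids C (c p)"
    and exchange: "usual_exchange n C c \<or> noncommutative_exchange n C c"


section \<open>Associative unital algebras\<close>

text \<open>The library locale \<^locale>\<open>algebra\<close> only covers commutative algebras.\<close>

locale unital_assoc_algebra = module R M + M?: ring M for R and M (structure) +
  assumes smult_mult_left: "\<lbrakk>r \<in> carrier R; x \<in> carrier M; y \<in> carrier M\<rbrakk> \<Longrightarrow>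
      (r \<odot>\<^bsub>M\<^esub> x) \<otimes>\<^bsub>M\<^esub> y = r \<odot>\<^bsub>M\<^esub> (x \<otimes>\<^bsub>M\<^esub> y)"
    and smult_mult_right: "\<lbrakk>r \<in> carrier R; x \<in> carrier M; y \<in> carrier M\<rbrakk> \<Longrightarrow>
      x \<otimes>\<^bsub>M\<^esub> (r \<odot>\<^bsub>M\<^esub> y) = r \<odot>\<^bsub>M\<^esub> (x \<otimes>\<^bsub>M\<^esub> y)"

definition module_hom :: "('k, 'm) ring_scheme \<Rightarrow> ('k, 'a, 'r) module_scheme \<Rightarrow>
    ('k, 'b, 's) module_scheme \<Rightarrow> ('a \<Rightarrow> 'b) set" where
  "module_hom R M N = {f \<in> carrier M \<rightarrow> carrier N.
    (\<forall>x\<in>carrier M. \<forall>y\<in>carrier M. f (x \<oplus>\<^bsub>M\<^esub> y) = f x \<oplus>\<^bsub>N\<^esub> f y) \<and>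
    (\<forall>r\<in>carrier R. \<forall>x\<in>carrier M. f (r \<odot>\<^bsub>M\<^esub> x) = r \<odot>\<^bsub>N\<^esub> f x)}"


section \<open>The constant bundle and its sections\<close>

text \<open>The element \<open>a\<^sub>x\<close> of the fibre over \<open>x\<close> is encoded as the pair \<open>(x, a)\<close>.\<close>

definition const_bundle :: "'x set \<Rightarrow> ('a, 'r) ring_scheme \<Rightarrow> ('x \<times> 'a) set" where
  "const_bundle X A = X \<times> carrier A"

definition bundle_comp :: "(nat \<Rightarrow> 'x pop) \<Rightarrow> ('a, 'r) ring_scheme \<Rightarrow> nat \<Rightarrow> ('x \<times> 'a) pop" where
  "bundle_comp c A p u v = map_option (\<lambda>z. (z, snd u \<otimes>\<^bsub>A\<^esub> snd v)) (c p (fst u) (fst v))"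

definition convolution :: "'x set \<Rightarrow> 'x pop \<Rightarrow> ('a, 'r) ring_scheme \<Rightarrow>
    ('x \<Rightarrow> 'a) \<Rightarrow> ('x \<Rightarrow> 'a) \<Rightarrow> 'x \<Rightarrow> 'a" where
  "convolution X c A \<sigma> \<rho> =
    (\<lambda>z\<in>X. \<Oplus>\<^bsub>A\<^esub>v \<in> {(x, y). x \<in> X \<and> y \<in> X \<and> c x y = Some z}. \<sigma> (fst v) \<otimes>\<^bsub>A\<^esub> \<rho> (snd v))"

text \<open>Sections with the pointwise module structure and the convolution product of one operation
  \<open>c\<close>. The ring record needs a unit, which is left as a parameter \<open>u\<close>.\<close>

definition section_algebra :: "'x set \<Rightarrow> 'x pop \<Rightarrow> ('k, 'a, 'r) module_scheme \<Rightarrow> ('x \<Rightarrow> 'a) \<Rightarrow>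
    ('k, 'x \<Rightarrow> 'a) module" where
  "section_algebra X c A u =
    \<lparr>carrier = X \<rightarrow>\<^sub>E carrier A,
     mult = convolution X c A,
     one = u,
     zero = (\<lambda>x\<in>X. \<zero>\<^bsub>A\<^esub>),
     add = (\<lambda>\<sigma> \<rho>. \<lambda>x\<in>X. \<sigma> x \<oplus>\<^bsub>A\<^esub> \<rho> x),
     smult = (\<lambda>r \<sigma>. \<lambda>x\<in>X. r \<odot>\<^bsub>A\<^esub> \<sigma> x)\<rparr>"

definition delta :: "'x set \<Rightarrow> ('a, 'r) ring_scheme \<Rightarrow> 'x \<Rightarrow> 'x \<Rightarrow> 'a" where
  "delta X A x = (\<lambda>y\<in>X. if x = y then \<one>\<^bsub>A\<^esub> else \<zero>\<^bsub>A\<^esub>)"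

definition bundle_emb :: "'x set \<Rightarrow> ('a, 'r) ring_scheme \<Rightarrow> 'x \<times> 'a \<Rightarrow> 'x \<Rightarrow> 'a" where
  "bundle_emb X A = (\<lambda>(x, a). \<lambda>y\<in>X. a \<otimes>\<^bsub>A\<^esub> delta X A x y)"

text \<open>An embedding of the bundle \<open>X \<times> A\<close> into a module \<open>N\<close>: linear and injective on each fibre, with
  distinct fibres meeting only in the zero vector (which the zero vectors of all fibres
  necessarily share, by linearity).\<close>

definition embeds_bundle :: "('k, 'm) ring_scheme \<Rightarrow> 'x set \<Rightarrow> ('k, 'a, 'r) module_scheme \<Rightarrow>
    ('k, 'b, 's) module_scheme \<Rightarrow> ('x \<times> 'a \<Rightarrow> 'b) \<Rightarrow> bool" where
  "embeds_bundle K X A N f \<longleftrightarrow>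
    (\<forall>x\<in>X. (\<lambda>a. f (x, a)) \<in> module_hom K A N \<and> inj_on (\<lambda>a. f (x, a)) (carrier A)) \<and>
    (\<forall>x\<in>X. \<forall>y\<in>X. x \<noteq> y \<longrightarrow>
      (\<lambda>a. f (x, a)) ` carrier A \<inter> (\<lambda>a. f (y, a)) ` carrier A \<subseteq> {\<zero>\<^bsub>N\<^esub>})"

end

theory Submission
  imports Defs
begin

text \<open>
  Everything rests on the behaviour of identities. In an arrows-only category each element has
  exactly one right and one left identity, and two elements compose as soon as the right identity
  of the first is a left identity of the second.

  For the convolution this gives the unit: it is the indicator section of the set of partial
  identities, because in \<open>\<sigma> * u\<close> at \<open>z\<close> the only surviving factorisation of \<open>z\<close> is the one through
  its unique right identity. Associativity holds because both bracketings, once expanded, sum the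
  products \<open>\<sigma>\<^sub>x \<rho>\<^sub>y \<tau>\<^sub>k\<close> over the triples whose composite is \<open>z\<close> (\<open>convolution_assoc\<close>); finiteness of
  \<open>X\<close> makes the sums meaningful.

  For the bundle, composing with \<open>l\<^sub>x\<close> where \<open>l\<close> is a unit forces a partial identity to have fibre
  component \<open>1\<close>, so the identities over \<open>X \<times> A\<close> are exactly the pairs \<open>(e, 1)\<close> with \<open>e\<close> an identity of
  \<open>X\<close> (\<open>partial_ids_bundle\<close>), and all category axioms are inherited. The only axiom that
  reorders fibre components is exchange. The usual law compares \<open>(x y)(w z)\<close> with \<open>(x w)(y z)\<close> in \<open>A\<close>,
  so over a nonempty \<open>X\<close> and with at least two operations it forces \<open>A\<close> to be commutative. The
  non-commutative law has an identity as one of the factors, whose fibre component is \<open>1\<close>, so it lifts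
  from \<open>X\<close> to the bundle for every \<open>A\<close>. It remains to see that \<open>X\<close> always satisfies the
  non-commutative law, that is, that the usual law implies it
  (\<open>usual_imp_noncommutative_exchange\<close>).
\<close>

section \<open>Identities in arrows-only categories\<close>

context one_category
begin

lemma partial_ids_closed: "e \<in> partial_ids C c \<Longrightarrow> e \<in> C"
  by (simp add: partial_ids_def)

lemma comp_right_id: "\<lbrakk>f \<in> C; r \<in> partial_ids C c; c f r = Some k\<rbrakk> \<Longrightarrow> k = f"
  by (simp add: partial_ids_def)

lemma comp_left_id: "\<lbrakk>f \<in> C; l \<in> partial_ids C c; c l f = Some k\<rbrakk> \<Longrightarrow> k = f"
  by (simp add: partial_ids_def)

lemma obtain_right_id:
  assumes "f \<in> C" obtains r where "r \<in> partial_ids C c" "c f r = Some f"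
  using right_id[OF assms] comp_right_id[OF assms] by fastforce

lemma obtain_left_id:
  assumes "f \<in> C" obtains l where "l \<in> partial_ids C c" "c l f = Some f"
  using left_id[OF assms] comp_left_id[OF assms] by fastforce

lemma partial_id_idem:
  assumes e: "e \<in> partial_ids C c" shows "c e e = Some e"
proof -
  obtain l where l: "l \<in> partial_ids C c" "c l e = Some e"
    using obtain_left_id[OF partial_ids_closed[OF e]] by blast
  then have "e = l"
    using comp_right_id[OF partial_ids_closed[OF l(1)] e] by simp
  with l show ?thesis by simp
qed

text \<open>If \<open>r\<close> is a right identity of \<open>f\<close>, then \<open>f g = (f r) g = f (r g)\<close>, so existence of the left side
  forces existence of \<open>r g\<close>: a right identity of \<open>f\<close> is a left identity of everything that \<open>f\<close>
  composes with. The next lemma is the mirror image.\<close>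

lemma right_id_acts:
  assumes "f \<in> C" "g \<in> C" "r \<in> partial_ids C c" "c f r \<noteq> None" "c f g \<noteq> None"
  shows "c r g \<noteq> None"
proof -
  have "c f r = Some f" using assms comp_right_id by fastforce
  then have "Option.bind (c r g) (c f) = c f g"
    using assoc[of f r g] assms partial_ids_closed by simp
  with assms show ?thesis by (cases "c r g") auto
qed

lemma left_id_acts:
  assumes "f \<in> C" "g \<in> C" "l \<in> partial_ids C c" "c l g \<noteq> None" "c f g \<noteq> None"
  shows "c f l \<noteq> None"
proof -
  have "c l g = Some g" using assms comp_left_id by fastforce
  then have "c f g = Option.bind (c f l) (\<lambda>k. c k g)"
    using assoc[of f l g] assms partial_ids_closed by simp
  with assms show ?thesis by (cases "c f l") auto
qed

lemma composable_ids_eq: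
  assumes "e \<in> partial_ids C c" "e' \<in> partial_ids C c" "c e e' \<noteq> None"
  shows "e = e'"
  using assms partial_ids_closed comp_right_id[of e e'] comp_left_id[of e' e] by fastforce

lemma right_id_unique:
  assumes "f \<in> C" "r \<in> partial_ids C c" "r' \<in> partial_ids C c" "c f r \<noteq> None" "c f r' \<noteq> None"
  shows "r = r'"
  using assms right_id_acts[of f r' r] composable_ids_eq partial_ids_closed by blast

lemma left_id_unique:
  assumes "f \<in> C" "l \<in> partial_ids C c" "l' \<in> partial_ids C c" "c l f \<noteq> None" "c l' f \<noteq> None"
  shows "l = l'"
  using assms left_id_acts[of l f l'] composable_ids_eq partial_ids_closed by blast

end

section \<open>The usual exchange property implies the non-commutative one\<close>

context strict_n_category
begin

text \<open>Writing \<open>\<iota> = \<iota> \<circ>\<^sub>p \<iota>\<close> turns \<open>\<iota> \<circ>\<^sub>q (x \<circ>\<^sub>p y)\<close> into an instance of the usual exchange law. What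
  exchange does not give directly is that the left side exists when only \<open>\<iota> \<circ>\<^sub>q x\<close> and
  \<open>\<iota> \<circ>\<^sub>q y\<close> do. For this, exchange is applied to the \<open>\<circ>\<^sub>q\<close>-left identity \<open>l\<close> of
  \<open>x \<circ>\<^sub>p y\<close>, which is also a \<open>\<circ>\<^sub>p\<close>-identity: it shows that \<open>l\<close> is the \<open>\<circ>\<^sub>q\<close>-left
  identity of \<open>x\<close> too, so that \<open>\<iota>\<close>, being composable with \<open>x\<close>, is composable with \<open>l\<close> and hence with
  \<open>x \<circ>\<^sub>p y\<close>.\<close>

lemma usual_imp_left_functor:
  assumes ex: "usual_exchange n C c" and qp: "q < p" "p < n"
    and \<iota>: "\<iota> \<in> partial_ids C (c p)"
  shows "partial_functor C (c p) (c q \<iota>)"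
proof -
  interpret P: one_category C "c p" using one_cat qp by simp
  interpret Q: one_category C "c q" using one_cat qp by simp
  have whisker: "\<exists>d e. c q i x = Some d \<and> c q i y = Some e \<and> c p d e = Some u"
    if "i \<in> partial_ids C (c p)" "x \<in> C" "y \<in> C" "c p x y = Some z" "c q i z = Some u"
    for i x y z u
    using ex qp that P.partial_id_idem[of i] P.partial_ids_closed[of i]
    unfolding usual_exchange_def by blast
  have ex_comp: "c q \<iota> z \<noteq> None"
    if xy: "x \<in> C" "y \<in> C" "c p x y = Some z" and \<iota>x: "c q \<iota> x \<noteq> None" for x y z
  proof -
    have z: "z \<in> C" using P.closed xy by blast
    obtain l where l: "l \<in> partial_ids C (c q)" "c q l z = Some z"
      using Q.obtain_left_id[OF z] by blast
    have "l \<in> partial_ids C (c p)" using l ids_mono[OF qp] by blast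
    then have "c q l x \<noteq> None" using whisker[OF _ xy l(2)] by auto
    then have "c q \<iota> l \<noteq> None"
      using Q.left_id_acts[of \<iota> x l] \<iota>x xy l(1) P.partial_ids_closed[OF \<iota>] by blast
    then show ?thesis
      using Q.comp_exists[of \<iota> z l] P.partial_ids_closed[OF \<iota>] z l by simp
  qed
  show ?thesis
    unfolding partial_functor_def
  proof (intro conjI ballI allI impI)
    fix x y z
    assume xy: "x \<in> C" "y \<in> C" "c p x y = Some z"
      and "c q \<iota> z \<noteq> None \<or> c q \<iota> x \<noteq> None \<and> c q \<iota> y \<noteq> None"
    then obtain u where "c q \<iota> z = Some u" using ex_comp by blast
    then show "\<exists>x' y' z'. c q \<iota> x = Some x' \<and> c q \<iota> y = Some y' \<and> c q \<iota> z = Some z' \<and>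
        c p x' y' = Some z'"
      using whisker[OF \<iota> xy] by blast
  qed (use ids_comp[OF qp \<iota>] in blast)
qed

lemma usual_imp_right_functor:
  assumes ex: "usual_exchange n C c" and qp: "q < p" "p < n"
    and \<iota>: "\<iota> \<in> partial_ids C (c p)"
  shows "partial_functor C (c p) (\<lambda>x. c q x \<iota>)"
proof -
  interpret P: one_category C "c p" using one_cat qp by simp
  interpret Q: one_category C "c q" using one_cat qp by simp
  have whisker: "\<exists>d e. c q x i = Some d \<and> c q y i = Some e \<and> c p d e = Some u"
    if "i \<in> partial_ids C (c p)" "x \<in> C" "y \<in> C" "c p x y = Some z" "c q z i = Some u"
    for i x y z u
    using ex qp that P.partial_id_idem[of i] P.partial_ids_closed[of i]
    unfolding usual_exchange_def by blast
  have ex_comp: "c q z \<iota> \<noteq> None"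
    if xy: "x \<in> C" "y \<in> C" "c p x y = Some z" and x\<iota>: "c q x \<iota> \<noteq> None" for x y z
  proof -
    have z: "z \<in> C" using P.closed xy by blast
    obtain r where r: "r \<in> partial_ids C (c q)" "c q z r = Some z"
      using Q.obtain_right_id[OF z] by blast
    have "r \<in> partial_ids C (c p)" using r ids_mono[OF qp] by blast
    then have "c q x r \<noteq> None" using whisker[OF _ xy r(2)] by auto
    then have "c q r \<iota> \<noteq> None"
      using Q.right_id_acts[of x \<iota> r] x\<iota> xy r(1) P.partial_ids_closed[OF \<iota>] by blast
    then show ?thesis
      using Q.comp_exists[of z \<iota> r] P.partial_ids_closed[OF \<iota>] z r by simp
  qed
  show ?thesis
    unfolding partial_functor_def
  proof (intro conjI ballI allI impI)
    fix x y z
    assume xy: "x \<in> C" "y \<in> C" "c p x y = Some z"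
      and "c q z \<iota> \<noteq> None \<or> c q x \<iota> \<noteq> None \<and> c q y \<iota> \<noteq> None"
    then obtain u where "c q z \<iota> = Some u" using ex_comp by blast
    then show "\<exists>x' y' z'. c q x \<iota> = Some x' \<and> c q y \<iota> = Some y' \<and> c q z \<iota> = Some z' \<and>
        c p x' y' = Some z'"
      using whisker[OF \<iota> xy] by blast
  qed (use ids_comp[OF qp _ \<iota>] in blast)
qed

lemma usual_imp_noncommutative_exchange:
  "usual_exchange n C c \<Longrightarrow> noncommutative_exchange n C c"
  unfolding noncommutative_exchange_def
  using usual_imp_left_functor usual_imp_right_functor by blast

lemma noncommutative_exchange: "noncommutative_exchange n C c"
  using exchange usual_imp_noncommutative_exchange by blast

end

section \<open>Finite sums over families of index sets\<close>

lemma (in comm_monoid) finprod_Sigma: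
  assumes "finite I" "\<And>i. i \<in> I \<Longrightarrow> finite (B i)"
    and f: "\<And>i j. \<lbrakk>i \<in> I; j \<in> B i\<rbrakk> \<Longrightarrow> f i j \<in> carrier G"
  shows "(\<Otimes>i\<in>I. \<Otimes>j\<in>B i. f i j) = (\<Otimes>v\<in>Sigma I B. f (fst v) (snd v))"
proof -
  have "(\<Otimes>v\<in>Sigma I B. f (fst v) (snd v)) = (\<Otimes>v\<in>(\<Union>i\<in>I. Pair i ` B i). f (fst v) (snd v))"
    by (rule arg_cong[where f = "finprod G _"]) auto
  also have "\<dots> = (\<Otimes>i\<in>I. \<Otimes>v\<in>Pair i ` B i. f (fst v) (snd v))"
    using assms by (intro finprod_UN_disjoint) (auto simp: pairwise_def disjnt_def)
  also have "\<dots> = (\<Otimes>i\<in>I. \<Otimes>j\<in>B i. f i j)"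
  proof (rule finprod_cong')
    fix i assume i: "i \<in> I"
    show "(\<Otimes>v\<in>Pair i ` B i. f (fst v) (snd v)) = (\<Otimes>j\<in>B i. f i j)"
      using f i by (subst finprod_reindex) (auto intro: inj_onI)
  qed (use f in \<open>auto intro!: finprod_closed\<close>)
  finally show ?thesis by simp
qed

lemma (in comm_monoid) finprod_Sigma_bij:
  assumes "finite I" "\<And>i. i \<in> I \<Longrightarrow> finite (B i)"
    and f: "\<And>i j. \<lbrakk>i \<in> I; j \<in> B i\<rbrakk> \<Longrightarrow> f i j \<in> carrier G"
    and h: "bij_betw h T (Sigma I B)"
    and g: "\<And>t. t \<in> T \<Longrightarrow> f (fst (h t)) (snd (h t)) = g t"
  shows "(\<Otimes>i\<in>I. \<Otimes>j\<in>B i. f i j) = (\<Otimes>t\<in>T. g t)"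
proof -
  have img: "h ` T = Sigma I B" and inj: "inj_on h T" using h by (auto simp: bij_betw_def)
  have mem: "h t \<in> Sigma I B" if "t \<in> T" for t using img that by blast
  have "(\<Otimes>i\<in>I. \<Otimes>j\<in>B i. f i j) = (\<Otimes>v\<in>h ` T. f (fst v) (snd v))"
    using finprod_Sigma[OF assms(1,2) f] img by simp
  also have "\<dots> = (\<Otimes>t\<in>T. f (fst (h t)) (snd (h t)))"
    by (rule finprod_reindex) (use f inj img in auto)
  also have "\<dots> = (\<Otimes>t\<in>T. g t)"
  proof (rule finprod_cong')
    show "g \<in> T \<rightarrow> carrier G"
    proof
      fix t assume t: "t \<in> T"
      have "f (fst (h t)) (snd (h t)) \<in> carrier G" using mem[OF t] by (auto intro: f)
      then show "g t \<in> carrier G" using g[OF t] by simp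
    qed
  qed (simp_all add: g)
  finally show ?thesis .
qed

section \<open>The convolution algebra of sections\<close>

abbreviation factorisations :: "'x set \<Rightarrow> 'x pop \<Rightarrow> 'x \<Rightarrow> ('x \<times> 'x) set" where
  "factorisations X c z \<equiv> {(x, y). x \<in> X \<and> y \<in> X \<and> c x y = Some z}"

definition unit_section :: "'x set \<Rightarrow> 'x pop \<Rightarrow> ('a, 'r) ring_scheme \<Rightarrow> 'x \<Rightarrow> 'a" where
  "unit_section X c A = (\<lambda>z\<in>X. if z \<in> partial_ids X c then \<one>\<^bsub>A\<^esub> else \<zero>\<^bsub>A\<^esub>)"

lemma finite_factorisations: "finite X \<Longrightarrow> finite (factorisations X c z)"
  by (rule finite_subset[of _ "X \<times> X"]) auto

lemma convolution_apply:
  "z \<in> X \<Longrightarrow> convolution X c A \<sigma> \<rho> z =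
    (\<Oplus>\<^bsub>A\<^esub>v\<in>factorisations X c z. \<sigma> (fst v) \<otimes>\<^bsub>A\<^esub> \<rho> (snd v))"
  by (simp add: convolution_def)

context ring
begin

lemma convolution_closed:
  assumes "\<sigma> \<in> X \<rightarrow> carrier R" "\<rho> \<in> X \<rightarrow> carrier R"
  shows "convolution X c R \<sigma> \<rho> \<in> X \<rightarrow>\<^sub>E carrier R"
  using assms unfolding convolution_def by (auto simp: Pi_def intro!: finsum_closed)

lemma convolution_add_left:
  assumes "\<sigma> \<in> X \<rightarrow> carrier R" "\<rho> \<in> X \<rightarrow> carrier R" "\<tau> \<in> X \<rightarrow> carrier R"
  shows "convolution X c R (\<lambda>x\<in>X. \<sigma> x \<oplus> \<rho> x) \<tau> =
    (\<lambda>x\<in>X. convolution X c R \<sigma> \<tau> x \<oplus> convolution X c R \<rho> \<tau> x)"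
proof
  fix z
  have "(\<Oplus>v\<in>factorisations X c z. (\<lambda>x\<in>X. \<sigma> x \<oplus> \<rho> x) (fst v) \<otimes> \<tau> (snd v)) =
      (\<Oplus>v\<in>factorisations X c z. \<sigma> (fst v) \<otimes> \<tau> (snd v) \<oplus> \<rho> (fst v) \<otimes> \<tau> (snd v))"
    using assms by (intro finsum_cong') (auto simp: l_distr Pi_def)
  also have "\<dots> = (\<Oplus>v\<in>factorisations X c z. \<sigma> (fst v) \<otimes> \<tau> (snd v)) \<oplus>
      (\<Oplus>v\<in>factorisations X c z. \<rho> (fst v) \<otimes> \<tau> (snd v))"
    using assms by (intro finsum_addf) (auto simp: Pi_def)
  finally show "convolution X c R (\<lambda>x\<in>X. \<sigma> x \<oplus> \<rho> x) \<tau> z =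
      (\<lambda>x\<in>X. convolution X c R \<sigma> \<tau> x \<oplus> convolution X c R \<rho> \<tau> x) z"
    by (simp add: convolution_def)
qed

lemma convolution_add_right:
  assumes "\<sigma> \<in> X \<rightarrow> carrier R" "\<rho> \<in> X \<rightarrow> carrier R" "\<tau> \<in> X \<rightarrow> carrier R"
  shows "convolution X c R \<tau> (\<lambda>x\<in>X. \<sigma> x \<oplus> \<rho> x) =
    (\<lambda>x\<in>X. convolution X c R \<tau> \<sigma> x \<oplus> convolution X c R \<tau> \<rho> x)"
proof
  fix z
  have "(\<Oplus>v\<in>factorisations X c z. \<tau> (fst v) \<otimes> (\<lambda>x\<in>X. \<sigma> x \<oplus> \<rho> x) (snd v)) =
      (\<Oplus>v\<in>factorisations X c z. \<tau> (fst v) \<otimes> \<sigma> (snd v) \<oplus> \<tau> (fst v) \<otimes> \<rho> (snd v))"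
    using assms by (intro finsum_cong') (auto simp: r_distr Pi_def)
  also have "\<dots> = (\<Oplus>v\<in>factorisations X c z. \<tau> (fst v) \<otimes> \<sigma> (snd v)) \<oplus>
      (\<Oplus>v\<in>factorisations X c z. \<tau> (fst v) \<otimes> \<rho> (snd v))"
    using assms by (intro finsum_addf) (auto simp: Pi_def)
  finally show "convolution X c R \<tau> (\<lambda>x\<in>X. \<sigma> x \<oplus> \<rho> x) z =
      (\<lambda>x\<in>X. convolution X c R \<tau> \<sigma> x \<oplus> convolution X c R \<tau> \<rho> x) z"
    by (simp add: convolution_def)
qed

text \<open>A factorisation \<open>(w, k)\<close> of \<open>z\<close> followed by a factorisation \<open>(x, y)\<close> of \<open>w\<close> is the same as a
  triple \<open>(x, y, k)\<close> with \<open>(x y) k = z\<close>, because \<open>w\<close> is determined by \<open>(x, y)\<close>; likewise for the other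
  bracketing. Associativity of the partial composition says that the two sets of triples agree.\<close>

lemma convolution_assoc:
  assumes cat: "one_category X c" and fin: "finite X"
    and S: "\<sigma> \<in> X \<rightarrow> carrier R" "\<rho> \<in> X \<rightarrow> carrier R" "\<tau> \<in> X \<rightarrow> carrier R"
  shows "convolution X c R (convolution X c R \<sigma> \<rho>) \<tau> =
    convolution X c R \<sigma> (convolution X c R \<rho> \<tau>)"
proof
  interpret one_category X c by fact
  fix z
  let ?F = "factorisations X c"
  let ?T = "{(x, y, k). x \<in> X \<and> y \<in> X \<and> k \<in> X \<and> Option.bind (c x y) (\<lambda>w. c w k) = Some z}"
  let ?g = "\<lambda>(x, y, k). \<sigma> x \<otimes> \<rho> y \<otimes> \<tau> k"
  have T': "?T = {(x, y, k). x \<in> X \<and> y \<in> X \<and> k \<in> X \<and> Option.bind (c y k) (c x) = Some z}"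
    using assoc by auto
  note finF = finite_factorisations[OF fin, of c]
  have memS: "\<sigma> x \<in> carrier R" "\<rho> x \<in> carrier R" "\<tau> x \<in> carrier R" if "x \<in> X" for x
    using S that by auto
  show "convolution X c R (convolution X c R \<sigma> \<rho>) \<tau> z =
      convolution X c R \<sigma> (convolution X c R \<rho> \<tau>) z"
  proof (cases "z \<in> X")
    case z: True
    have "convolution X c R (convolution X c R \<sigma> \<rho>) \<tau> z =
        (\<Oplus>v\<in>?F z. \<Oplus>u\<in>?F (fst v). \<sigma> (fst u) \<otimes> \<rho> (snd u) \<otimes> \<tau> (snd v))"
      unfolding convolution_apply[OF z]
    proof (rule finsum_cong')
      fix v assume v: "v \<in> ?F z"
      then have "convolution X c R \<sigma> \<rho> (fst v) = (\<Oplus>u\<in>?F (fst v). \<sigma> (fst u) \<otimes> \<rho> (snd u))"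
        by (intro convolution_apply) auto
      then show "convolution X c R \<sigma> \<rho> (fst v) \<otimes> \<tau> (snd v) =
          (\<Oplus>u\<in>?F (fst v). \<sigma> (fst u) \<otimes> \<rho> (snd u) \<otimes> \<tau> (snd v))"
        using v by (simp only:, intro finsum_ldistr[OF finF]) (auto simp: memS)
    qed (rule refl, intro Pi_I finsum_closed m_closed memS, auto)
    also have "\<dots> = (\<Oplus>t\<in>?T. ?g t)"
    proof (rule add.finprod_Sigma_bij[where h = "\<lambda>(x, y, k). ((the (c x y), k), (x, y))"])
      show "bij_betw (\<lambda>(x, y, k). ((the (c x y), k), (x, y))) ?T (Sigma (?F z) (\<lambda>v. ?F (fst v)))"
        by (rule bij_betwI[where g = "\<lambda>((w, k), (x, y)). (x, y, k)"])
          (auto simp: bind_eq_Some_conv dest: closed[rotated 2])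
    qed (auto simp: finF memS bind_eq_Some_conv)
    also have "\<dots> = (\<Oplus>v\<in>?F z. \<Oplus>u\<in>?F (snd v). \<sigma> (fst v) \<otimes> (\<rho> (fst u) \<otimes> \<tau> (snd u)))"
    proof (rule add.finprod_Sigma_bij[symmetric,
          where h = "\<lambda>(x, y, k). ((x, the (c y k)), (y, k))"])
      show "bij_betw (\<lambda>(x, y, k). ((x, the (c y k)), (y, k))) ?T (Sigma (?F z) (\<lambda>v. ?F (snd v)))"
        unfolding T'
        by (rule bij_betwI[where g = "\<lambda>((x, w), (y, k)). (x, y, k)"])
          (auto simp: bind_eq_Some_conv dest: closed[rotated 2])
    qed (auto simp: finF memS m_assoc bind_eq_Some_conv)
    also have "\<dots> = convolution X c R \<sigma> (convolution X c R \<rho> \<tau>) z"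
      unfolding convolution_apply[OF z]
    proof (rule finsum_cong'[OF refl])
      fix v assume v: "v \<in> ?F z"
      then have "convolution X c R \<rho> \<tau> (snd v) = (\<Oplus>u\<in>?F (snd v). \<rho> (fst u) \<otimes> \<tau> (snd u))"
        by (intro convolution_apply) auto
      then show "(\<Oplus>u\<in>?F (snd v). \<sigma> (fst v) \<otimes> (\<rho> (fst u) \<otimes> \<tau> (snd u))) =
          \<sigma> (fst v) \<otimes> convolution X c R \<rho> \<tau> (snd v)"
        using v by (simp only:, intro finsum_rdistr[OF finF, symmetric]) (auto simp: memS)
    qed (auto simp: memS convolution_closed[OF S(2,3), THEN PiE_mem])
    finally show ?thesis .
  qed (simp add: convolution_def)
qed

text \<open>If \<open>x y = z\<close> with \<open>y\<close> an identity, then \<open>x = z\<close> and \<open>y\<close> is the unique right identity of \<open>z\<close>, so a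
  single factorisation of \<open>z\<close> contributes.\<close>

lemma convolution_unit_right:
  assumes cat: "one_category X c" and fin: "finite X" and S: "\<sigma> \<in> X \<rightarrow>\<^sub>E carrier R"
  shows "convolution X c R \<sigma> (unit_section X c R) = \<sigma>"
proof
  interpret one_category X c by fact
  fix z
  show "convolution X c R \<sigma> (unit_section X c R) z = \<sigma> z"
  proof (cases "z \<in> X")
    case z: True
    obtain r where r: "r \<in> partial_ids X c" "c z r = Some z"
      using obtain_right_id[OF z] by blast
    have only: "u = z \<and> v = r" if "u \<in> X" "v \<in> partial_ids X c" "c u v = Some z" for u v
      using that comp_right_id[of u v z] right_id_unique[of z v r] r by auto
    have memS: "\<sigma> x \<in> carrier R" if "x \<in> X" for x using S that by auto
    have "convolution X c R \<sigma> (unit_section X c R) z =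
        (\<Oplus>v\<in>{(z, r)}. \<sigma> (fst v) \<otimes> unit_section X c R (snd v))"
      unfolding convolution_apply[OF z]
    proof (rule add.finprod_mono_neutral_cong_right)
      show "finite (factorisations X c z)" using finite_factorisations[OF fin] .
      show "{(z, r)} \<subseteq> factorisations X c z" using z r partial_ids_closed by auto
      fix v assume v: "v \<in> factorisations X c z - {(z, r)}"
      have "snd v \<notin> partial_ids X c"
        using v only[of "fst v" "snd v"] by auto
      then show "\<sigma> (fst v) \<otimes> unit_section X c R (snd v) = \<zero>"
        using v by (auto simp: unit_section_def memS)
    qed (auto simp: unit_section_def memS)
    also have "\<dots> = \<sigma> z"
      using z r memS partial_ids_closed by (simp add: unit_section_def)
    finally show ?thesis .
  qed (use S in \<open>auto simp: convolution_def\<close>)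
qed

lemma convolution_unit_left:
  assumes cat: "one_category X c" and fin: "finite X" and S: "\<sigma> \<in> X \<rightarrow>\<^sub>E carrier R"
  shows "convolution X c R (unit_section X c R) \<sigma> = \<sigma>"
proof
  interpret one_category X c by fact
  fix z
  show "convolution X c R (unit_section X c R) \<sigma> z = \<sigma> z"
  proof (cases "z \<in> X")
    case z: True
    obtain l where l: "l \<in> partial_ids X c" "c l z = Some z"
      using obtain_left_id[OF z] by blast
    have only: "v = z \<and> u = l" if "u \<in> partial_ids X c" "v \<in> X" "c u v = Some z" for u v
      using that comp_left_id[of v u z] left_id_unique[of z u l] l by auto
    have memS: "\<sigma> x \<in> carrier R" if "x \<in> X" for x using S that by auto
    have "convolution X c R (unit_section X c R) \<sigma> z =
        (\<Oplus>v\<in>{(l, z)}. unit_section X c R (fst v) \<otimes> \<sigma> (snd v))"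
      unfolding convolution_apply[OF z]
    proof (rule add.finprod_mono_neutral_cong_right)
      show "finite (factorisations X c z)" using finite_factorisations[OF fin] .
      show "{(l, z)} \<subseteq> factorisations X c z" using z l partial_ids_closed by auto
      fix v assume v: "v \<in> factorisations X c z - {(l, z)}"
      have "fst v \<notin> partial_ids X c"
        using v only[of "fst v" "snd v"] by auto
      then show "unit_section X c R (fst v) \<otimes> \<sigma> (snd v) = \<zero>"
        using v by (auto simp: unit_section_def memS)
    qed (auto simp: unit_section_def memS)
    also have "\<dots> = \<sigma> z"
      using z l memS partial_ids_closed by (simp add: unit_section_def)
    finally show ?thesis .
  qed (use S in \<open>auto simp: convolution_def\<close>)
qed

end

lemma (in unital_assoc_algebra) finsum_smult_right:
  assumes "finite I" "r \<in> carrier R" "f \<in> I \<rightarrow> carrier M"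
  shows "r \<odot>\<^bsub>M\<^esub> (\<Oplus>\<^bsub>M\<^esub>i\<in>I. f i) = (\<Oplus>\<^bsub>M\<^esub>i\<in>I. r \<odot>\<^bsub>M\<^esub> f i)"
  using assms(1,3)
proof (induction I)
  case empty
  then show ?case using assms(2) by (simp add: smult_r_null)
next
  case (insert i I)
  then show ?case using assms(2) by (simp add: Pi_def smult_r_distr)
qed

lemma section_algebra_simps:
  "carrier (section_algebra X c A u) = X \<rightarrow>\<^sub>E carrier A"
  "mult (section_algebra X c A u) = convolution X c A"
  "one (section_algebra X c A u) = u"
  "zero (section_algebra X c A u) = (\<lambda>x\<in>X. \<zero>\<^bsub>A\<^esub>)"
  "add (section_algebra X c A u) \<sigma> \<rho> = (\<lambda>x\<in>X. \<sigma> x \<oplus>\<^bsub>A\<^esub> \<rho> x)"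
  "smult (section_algebra X c A u) r \<sigma> = (\<lambda>x\<in>X. r \<odot>\<^bsub>A\<^esub> \<sigma> x)"
  by (simp_all add: section_algebra_def)

context unital_assoc_algebra
begin

lemma section_algebra_abelian_group: "abelian_group (section_algebra X c M u)"
proof (rule abelian_groupI)
  fix \<sigma> assume \<sigma>: "\<sigma> \<in> carrier (section_algebra X c M u)"
  then have "\<sigma> x \<in> carrier M" if "x \<in> X" for x
    using that by (auto simp: section_algebra_simps)
  then have "(\<lambda>x\<in>X. \<ominus>\<^bsub>M\<^esub> \<sigma> x) \<in> carrier (section_algebra X c M u)"
    "(\<lambda>x\<in>X. \<ominus>\<^bsub>M\<^esub> \<sigma> x) \<oplus>\<^bsub>section_algebra X c M u\<^esub> \<sigma> = \<zero>\<^bsub>section_algebra X c M u\<^esub>"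
    by (auto simp: section_algebra_simps M.l_neg intro!: restrict_ext)
  then show "\<exists>\<rho>\<in>carrier (section_algebra X c M u).
      \<rho> \<oplus>\<^bsub>section_algebra X c M u\<^esub> \<sigma> = \<zero>\<^bsub>section_algebra X c M u\<^esub>"
    by blast
next
  fix \<sigma> assume \<sigma>: "\<sigma> \<in> carrier (section_algebra X c M u)"
  show "\<zero>\<^bsub>section_algebra X c M u\<^esub> \<oplus>\<^bsub>section_algebra X c M u\<^esub> \<sigma> = \<sigma>"
    by (rule extensionalityI[of _ X]) (use \<sigma> in \<open>auto simp: section_algebra_simps PiE_iff\<close>)
qed (auto simp: section_algebra_simps M.a_ac PiE_iff intro!: restrict_ext)

lemma section_algebra_module: "module R (section_algebra X c M u)"
proof (rule moduleI)
  show "cring R" by (rule R.is_cring)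
  show "abelian_group (section_algebra X c M u)" by (rule section_algebra_abelian_group)
  fix \<sigma> assume \<sigma>: "\<sigma> \<in> carrier (section_algebra X c M u)"
  show "\<one>\<^bsub>R\<^esub> \<odot>\<^bsub>section_algebra X c M u\<^esub> \<sigma> = \<sigma>"
    by (rule extensionalityI[of _ X]) (use \<sigma> in \<open>auto simp: section_algebra_simps PiE_iff\<close>)
qed (auto simp: section_algebra_simps PiE_iff smult_l_distr smult_r_distr smult_assoc1
    intro!: restrict_ext)

lemma convolution_smult_left:
  assumes fin: "finite X" and r: "r \<in> carrier R"
    and S: "\<sigma> \<in> X \<rightarrow> carrier M" "\<rho> \<in> X \<rightarrow> carrier M"
  shows "convolution X c M (\<lambda>x\<in>X. r \<odot>\<^bsub>M\<^esub> \<sigma> x) \<rho> = (\<lambda>x\<in>X. r \<odot>\<^bsub>M\<^esub> convolution X c M \<sigma> \<rho> x)"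
proof
  fix z
  have "(\<Oplus>\<^bsub>M\<^esub>v\<in>factorisations X c z. (\<lambda>x\<in>X. r \<odot>\<^bsub>M\<^esub> \<sigma> x) (fst v) \<otimes>\<^bsub>M\<^esub> \<rho> (snd v)) =
      (\<Oplus>\<^bsub>M\<^esub>v\<in>factorisations X c z. r \<odot>\<^bsub>M\<^esub> (\<sigma> (fst v) \<otimes>\<^bsub>M\<^esub> \<rho> (snd v)))"
    using r S by (intro M.finsum_cong') (auto simp: smult_mult_left Pi_def)
  also have "\<dots> = r \<odot>\<^bsub>M\<^esub> (\<Oplus>\<^bsub>M\<^esub>v\<in>factorisations X c z. \<sigma> (fst v) \<otimes>\<^bsub>M\<^esub> \<rho> (snd v))"
    using r S by (intro finsum_smult_right[symmetric] finite_factorisations fin) (auto simp: Pi_def)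
  finally show "convolution X c M (\<lambda>x\<in>X. r \<odot>\<^bsub>M\<^esub> \<sigma> x) \<rho> z =
      (\<lambda>x\<in>X. r \<odot>\<^bsub>M\<^esub> convolution X c M \<sigma> \<rho> x) z"
    by (simp add: convolution_def)
qed

lemma convolution_smult_right:
  assumes fin: "finite X" and r: "r \<in> carrier R"
    and S: "\<sigma> \<in> X \<rightarrow> carrier M" "\<rho> \<in> X \<rightarrow> carrier M"
  shows "convolution X c M \<sigma> (\<lambda>x\<in>X. r \<odot>\<^bsub>M\<^esub> \<rho> x) = (\<lambda>x\<in>X. r \<odot>\<^bsub>M\<^esub> convolution X c M \<sigma> \<rho> x)"
proof
  fix z
  have "(\<Oplus>\<^bsub>M\<^esub>v\<in>factorisations X c z. \<sigma> (fst v) \<otimes>\<^bsub>M\<^esub> (\<lambda>x\<in>X. r \<odot>\<^bsub>M\<^esub> \<rho> x) (snd v)) =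
      (\<Oplus>\<^bsub>M\<^esub>v\<in>factorisations X c z. r \<odot>\<^bsub>M\<^esub> (\<sigma> (fst v) \<otimes>\<^bsub>M\<^esub> \<rho> (snd v)))"
    using r S by (intro M.finsum_cong') (auto simp: smult_mult_right Pi_def)
  also have "\<dots> = r \<odot>\<^bsub>M\<^esub> (\<Oplus>\<^bsub>M\<^esub>v\<in>factorisations X c z. \<sigma> (fst v) \<otimes>\<^bsub>M\<^esub> \<rho> (snd v))"
    using r S by (intro finsum_smult_right[symmetric] finite_factorisations fin) (auto simp: Pi_def)
  finally show "convolution X c M \<sigma> (\<lambda>x\<in>X. r \<odot>\<^bsub>M\<^esub> \<rho> x) z =
      (\<lambda>x\<in>X. r \<odot>\<^bsub>M\<^esub> convolution X c M \<sigma> \<rho> x) z"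
    by (simp add: convolution_def)
qed

theorem section_algebra_unital_assoc:
  assumes cat: "one_category X c" and fin: "finite X"
  shows "unital_assoc_algebra R (section_algebra X c M (unit_section X c M))"
    (is "unital_assoc_algebra R ?S")
proof (rule unital_assoc_algebra.intro)
  have ext: "\<sigma> \<in> X \<rightarrow> carrier M" if "\<sigma> \<in> X \<rightarrow>\<^sub>E carrier M" for \<sigma>
    using that by auto
  show "module R ?S" by (rule section_algebra_module)
  have "unit_section X c M \<in> X \<rightarrow>\<^sub>E carrier M"
    by (auto simp: unit_section_def)
  then have "monoid ?S"
    using cat fin ext
    by (intro monoidI)
      (simp_all add: section_algebra_simps M.convolution_assoc M.convolution_unit_left
        M.convolution_unit_right M.convolution_closed)
  then show "ring ?S"
    using ext
    by (intro ringI section_algebra_abelian_group)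
      (auto simp: section_algebra_simps M.convolution_add_left M.convolution_add_right)
  show "unital_assoc_algebra_axioms R ?S"
    using fin ext
    by unfold_locales
      (auto simp: section_algebra_simps convolution_smult_left convolution_smult_right)
qed

section \<open>Embedding the bundle\<close>

lemma bundle_emb_apply:
  assumes "a \<in> carrier M" "y \<in> X"
  shows "bundle_emb X M (x, a) y = (if y = x then a else \<zero>\<^bsub>M\<^esub>)"
  using assms by (simp add: bundle_emb_def delta_def)

lemma bundle_emb_closed:
  "a \<in> carrier M \<Longrightarrow> bundle_emb X M (x, a) \<in> X \<rightarrow>\<^sub>E carrier M"
  by (auto simp: bundle_emb_def delta_def)

lemma bundle_emb_eqI:
  assumes "a \<in> carrier M" "f \<in> extensional X"
    and "\<And>y. y \<in> X \<Longrightarrow> f y = (if y = x then a else \<zero>\<^bsub>M\<^esub>)"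
  shows "f = bundle_emb X M (x, a)"
  by (rule extensionalityI[of _ X])
    (use assms bundle_emb_closed[of a X x] in \<open>auto simp: bundle_emb_apply PiE_iff\<close>)

theorem bundle_embeds: "embeds_bundle R X M (section_algebra X c M u) (bundle_emb X M)"
  unfolding embeds_bundle_def
proof (intro conjI ballI impI)
  fix x assume x: "x \<in> X"
  show "(\<lambda>a. bundle_emb X M (x, a)) \<in> module_hom R M (section_algebra X c M u)"
    unfolding module_hom_def section_algebra_simps
  proof (intro CollectI conjI ballI Pi_I bundle_emb_closed bundle_emb_eqI[symmetric])
  qed (auto simp: bundle_emb_apply)
  show "inj_on (\<lambda>a. bundle_emb X M (x, a)) (carrier M)"
  proof (rule inj_onI)
    fix a b
    assume "a \<in> carrier M" "b \<in> carrier M" "bundle_emb X M (x, a) = bundle_emb X M (x, b)"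
    then show "a = b"
      using x bundle_emb_apply[of _ x X x] by metis
  qed
next
  fix x y assume xy: "x \<in> X" "y \<in> X" "x \<noteq> y"
  show "(\<lambda>a. bundle_emb X M (x, a)) ` carrier M \<inter> (\<lambda>a. bundle_emb X M (y, a)) ` carrier M
      \<subseteq> {\<zero>\<^bsub>section_algebra X c M u\<^esub>}"
  proof clarsimp
    fix a b assume ab: "a \<in> carrier M" "b \<in> carrier M"
      and eq: "bundle_emb X M (x, a) = bundle_emb X M (y, b)"
    \<comment> \<open>Evaluating at \<open>x\<close> sees \<open>a\<close> on one side and \<open>0\<close> on the other.\<close>
    have "a = \<zero>\<^bsub>M\<^esub>"
      using fun_cong[OF eq, of x] xy ab by (simp add: bundle_emb_apply)
    then have "bundle_emb X M (x, a) = (\<lambda>x\<in>X. \<zero>\<^bsub>M\<^esub>)"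
      by (intro bundle_emb_eqI[symmetric]) auto
    then show "bundle_emb X M (y, b) = \<zero>\<^bsub>section_algebra X c M u\<^esub>"
      using eq by (simp add: section_algebra_simps)
  qed
qed

text \<open>The two sections are supported at the single points \<open>x\<close> and \<open>y\<close>, so \<open>(x, y)\<close> is the only pair
  that can contribute to the convolution, and it contributes at \<open>x y\<close>.\<close>

theorem convolution_bundle_emb:
  assumes fin: "finite X"
    and xy: "x \<in> X" "y \<in> X" "c x y = Some z" and ab: "a \<in> carrier M" "b \<in> carrier M"
  shows "convolution X c M (bundle_emb X M (x, a)) (bundle_emb X M (y, b)) =
    bundle_emb X M (z, a \<otimes>\<^bsub>M\<^esub> b)"
proof (rule bundle_emb_eqI)
  fix k assume k: "k \<in> X"
  show "convolution X c M (bundle_emb X M (x, a)) (bundle_emb X M (y, b)) k =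
      (if k = z then a \<otimes>\<^bsub>M\<^esub> b else \<zero>\<^bsub>M\<^esub>)"
  proof -
    have "convolution X c M (bundle_emb X M (x, a)) (bundle_emb X M (y, b)) k =
        (\<Oplus>\<^bsub>M\<^esub>v\<in>{(x, y)} \<inter> factorisations X c k. a \<otimes>\<^bsub>M\<^esub> b)"
      unfolding convolution_apply[OF k]
      by (rule M.add.finprod_mono_neutral_cong_right)
        (use fin ab in \<open>auto simp: finite_factorisations bundle_emb_apply split: if_splits\<close>)
    also have "{(x, y)} \<inter> factorisations X c k = (if k = z then {(x, y)} else {})"
      using xy by auto
    finally show ?thesis using ab by simp
  qed
qed (use ab in \<open>auto simp: convolution_def\<close>)

end

section \<open>The category structure on the bundle\<close>

lemma bundle_comp_Pair:
  "bundle_comp c A p (x, a) (y, b) = map_option (\<lambda>z. (z, a \<otimes>\<^bsub>A\<^esub> b)) (c p x y)"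
  by (simp add: bundle_comp_def)

context ring
begin

text \<open>Composing \<open>(e, a)\<close> with the element \<open>(l, 1)\<close> over a left identity \<open>l\<close> of \<open>e\<close> has to give
  \<open>(l, 1)\<close> back, so \<open>a = 1\<close>.\<close>

lemma partial_ids_bundle:
  assumes "one_category X (c p)"
  shows "partial_ids (const_bundle X R) (bundle_comp c R p) = partial_ids X (c p) \<times> {\<one>}"
    (is "?L = ?R")
proof
  interpret one_category X "c p" by fact
  show "?R \<subseteq> ?L"
    by (auto simp: partial_ids_def const_bundle_def bundle_comp_Pair)
  show "?L \<subseteq> ?R"
  proof
    fix v assume v: "v \<in> ?L"
    then obtain e a where ea: "v = (e, a)" "e \<in> X" "a \<in> carrier R"
      by (auto simp: partial_ids_def const_bundle_def)
    have e: "e \<in> partial_ids X (c p)"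
      using v ea one_closed
      by (fastforce simp: partial_ids_def const_bundle_def bundle_comp_Pair)
    obtain l where l: "l \<in> partial_ids X (c p)" "c p l e = Some e"
      using obtain_left_id[OF ea(2)] by blast
    then have "bundle_comp c R p (l, \<one>) (e, a) = Some (e, a)"
      using ea by (simp add: bundle_comp_Pair)
    moreover have "(l, \<one>) \<in> const_bundle X R"
      using l partial_ids_closed by (simp add: const_bundle_def)
    ultimately have "(e, a) = (l, \<one>)"
      using v ea by (auto simp: partial_ids_def)
    with e ea show "v \<in> ?R" by simp
  qed
qed

lemma one_category_bundle:
  assumes "one_category X (c p)"
  shows "one_category (const_bundle X R) (bundle_comp c R p)"
proof -
  interpret one_category X "c p" by fact
  note ids = partial_ids_bundle[where c = c and p = p, OF assms]
  show ?thesis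
  proof
    fix f g h
    assume "f \<in> const_bundle X R" "g \<in> const_bundle X R" "bundle_comp c R p f g = Some h"
    then show "h \<in> const_bundle X R"
      by (auto simp: const_bundle_def bundle_comp_Pair intro: closed)
  next
    fix f g h
    assume "f \<in> const_bundle X R" "g \<in> const_bundle X R" "h \<in> const_bundle X R"
    then obtain x y z a b d where fgh: "f = (x, a)" "g = (y, b)" "h = (z, d)"
      "x \<in> X" "y \<in> X" "z \<in> X" "a \<in> carrier R" "b \<in> carrier R" "d \<in> carrier R"
      by (auto simp: const_bundle_def)
    have "Option.bind (bundle_comp c R p g h) (bundle_comp c R p f) =
        map_option (\<lambda>z. (z, a \<otimes> (b \<otimes> d))) (Option.bind (c p y z) (c p x))"
      by (cases "c p y z") (simp_all add: fgh bundle_comp_Pair)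
    also have "\<dots> = map_option (\<lambda>z. (z, a \<otimes> b \<otimes> d)) (Option.bind (c p x y) (\<lambda>k. c p k z))"
      using assoc[of x y z] fgh by (simp add: m_assoc)
    also have "\<dots> = Option.bind (bundle_comp c R p f g) (\<lambda>k. bundle_comp c R p k h)"
      by (cases "c p x y") (simp_all add: fgh bundle_comp_Pair)
    finally show "Option.bind (bundle_comp c R p g h) (bundle_comp c R p f) =
        Option.bind (bundle_comp c R p f g) (\<lambda>k. bundle_comp c R p k h)" .
  next
    fix f assume "f \<in> const_bundle X R"
    then show "\<exists>r\<in>partial_ids (const_bundle X R) (bundle_comp c R p).
        bundle_comp c R p f r \<noteq> None"
      using right_id by (auto simp: ids[unfolded const_bundle_def] const_bundle_def bundle_comp_Pair)
  next
    fix f assume "f \<in> const_bundle X R"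
    then show "\<exists>l\<in>partial_ids (const_bundle X R) (bundle_comp c R p).
        bundle_comp c R p l f \<noteq> None"
      using left_id by (auto simp: ids[unfolded const_bundle_def] const_bundle_def bundle_comp_Pair)
  next
    fix f g e
    assume "f \<in> const_bundle X R" "g \<in> const_bundle X R"
      "e \<in> partial_ids (const_bundle X R) (bundle_comp c R p)"
      "bundle_comp c R p f e \<noteq> None" "bundle_comp c R p e g \<noteq> None"
    then show "bundle_comp c R p f g \<noteq> None"
      using comp_exists[of "fst f" "fst g" "fst e"]
      by (auto simp: ids[unfolded const_bundle_def] const_bundle_def bundle_comp_Pair)
  qed
qed

text \<open>The maps to which this is applied are compositions with an identity \<open>(\<iota>, 1)\<close>, which leave the
  fibre component alone.\<close>

lemma partial_functor_bundle:
  assumes cat: "one_category X (c p)" and \<phi>: "partial_functor X (c p) \<phi>"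
    and \<Phi>: "\<And>x a. \<lbrakk>x \<in> X; a \<in> carrier R\<rbrakk> \<Longrightarrow> \<Phi> (x, a) = map_option (\<lambda>z. (z, a)) (\<phi> x)"
  shows "partial_functor (const_bundle X R) (bundle_comp c R p) \<Phi>"
  unfolding partial_functor_def
proof (intro conjI ballI allI impI)
  fix v w t
  assume "v \<in> const_bundle X R" "w \<in> const_bundle X R" "bundle_comp c R p v w = Some t"
    and def: "\<Phi> t \<noteq> None \<or> \<Phi> v \<noteq> None \<and> \<Phi> w \<noteq> None"
  then obtain x y z a b where vwt: "v = (x, a)" "w = (y, b)" "t = (z, a \<otimes> b)"
    "x \<in> X" "y \<in> X" "a \<in> carrier R" "b \<in> carrier R" "c p x y = Some z"
    by (auto simp: const_bundle_def bundle_comp_Pair)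
  have z: "z \<in> X" using one_category.closed[OF cat] vwt by blast
  have "\<phi> z \<noteq> None \<or> \<phi> x \<noteq> None \<and> \<phi> y \<noteq> None"
    using def vwt z by (simp add: \<Phi>)
  then obtain x' y' z' where "\<phi> x = Some x'" "\<phi> y = Some y'" "\<phi> z = Some z'" "c p x' y' = Some z'"
    using \<phi> vwt unfolding partial_functor_def by blast
  then show "\<exists>v' w' t'. \<Phi> v = Some v' \<and> \<Phi> w = Some w' \<and> \<Phi> t = Some t' \<and>
      bundle_comp c R p v' w' = Some t'"
    using vwt z by (simp add: \<Phi> bundle_comp_Pair)
next
  fix e e'
  assume "e \<in> partial_ids (const_bundle X R) (bundle_comp c R p)" "\<Phi> e = Some e'"
  then show "e' \<in> partial_ids (const_bundle X R) (bundle_comp c R p)"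
    using \<phi> \<Phi> one_category.partial_ids_closed[OF cat]
    unfolding partial_functor_def by (auto simp: partial_ids_bundle[where c = c, OF cat])
qed

lemma noncommutative_exchange_bundle:
  assumes "strict_n_category n X c"
  shows "noncommutative_exchange n (const_bundle X R) (bundle_comp c R)"
  unfolding noncommutative_exchange_def
proof (intro allI impI ballI)
  interpret strict_n_category n X c by fact
  fix p q \<iota>
  assume qp: "q < p" "p < n"
    and "\<iota> \<in> partial_ids (const_bundle X R) (bundle_comp c R p)"
  then obtain i where i: "i \<in> partial_ids X (c p)" "\<iota> = (i, \<one>)"
    using partial_ids_bundle[where c = c and p = p, OF one_cat[OF qp(2)]] by auto
  then have "partial_functor X (c p) (c q i)" "partial_functor X (c p) (\<lambda>x. c q x i)"
    using noncommutative_exchange qp unfolding noncommutative_exchange_def by blast+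
  then show "partial_functor (const_bundle X R) (bundle_comp c R p) (\<lambda>x. bundle_comp c R q \<iota> x) \<and>
      partial_functor (const_bundle X R) (bundle_comp c R p) (\<lambda>x. bundle_comp c R q x \<iota>)"
    using i one_cat[OF qp(2)] partial_functor_bundle[where c = c and p = p and \<phi> = "c q i"]
      partial_functor_bundle[where c = c and p = p and \<phi> = "\<lambda>x. c q x i"]
    by (simp add: bundle_comp_Pair)
qed

theorem strict_n_category_bundle:
  assumes "strict_n_category n X c"
  shows "strict_n_category n (const_bundle X R) (bundle_comp c R)"
proof -
  interpret strict_n_category n X c by fact
  note ids = partial_ids_bundle[where c = c, OF one_cat]
  show ?thesis
  proof (rule strict_n_category.intro)
    fix p assume "p < n"
    then show "one_category (const_bundle X R) (bundle_comp c R p)"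
      using one_category_bundle one_cat by blast
  next
    fix q p assume "q < p" "p < n"
    then show "partial_ids (const_bundle X R) (bundle_comp c R q)
        \<subseteq> partial_ids (const_bundle X R) (bundle_comp c R p)"
      using ids_mono by (auto simp: ids)
  next
    fix q p e f g
    assume qp: "q < p" "p < n"
      and "e \<in> partial_ids (const_bundle X R) (bundle_comp c R p)"
        "f \<in> partial_ids (const_bundle X R) (bundle_comp c R p)"
        "bundle_comp c R q e f = Some g"
    then obtain i j k where "i \<in> partial_ids X (c p)" "j \<in> partial_ids X (c p)"
      "c q i j = Some k" "g = (k, \<one>)"
      by (auto simp: ids[OF qp(2)] bundle_comp_Pair)
    then show "g \<in> partial_ids (const_bundle X R) (bundle_comp c R p)"
      using ids_comp[OF qp, of i j k] by (simp add: ids[OF qp(2)])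
  qed (use noncommutative_exchange_bundle assms in blast)
qed

text \<open>Over a \<open>\<circ>\<^sub>0\<close>-identity \<open>r\<close>, which is also a \<open>\<circ>\<^sub>1\<close>-identity, all composites in the exchange law
  exist and equal \<open>r\<close>. With fibre components \<open>1, a, b, 1\<close> the law reads \<open>a b = b a\<close>: this is the
  Eckmann--Hilton argument.\<close>

theorem usual_exchange_bundle_commutes:
  assumes "strict_n_category n X c" and n: "2 \<le> n" and X: "X \<noteq> {}"
    and ex: "usual_exchange n (const_bundle X R) (bundle_comp c R)"
    and ab: "a \<in> carrier R" "b \<in> carrier R"
  shows "a \<otimes> b = b \<otimes> a"
proof -
  interpret strict_n_category n X c by fact
  interpret C0: one_category X "c 0" using one_cat n by simp
  interpret C1: one_category X "c 1" using one_cat n by simp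
  obtain r where r: "r \<in> partial_ids X (c 0)"
    using X C0.right_id by blast
  have "r \<in> partial_ids X (c 1)" using r ids_mono[of 0 1] n by auto
  then have rr: "c 0 r r = Some r" "c 1 r r = Some r" and rX: "r \<in> X"
    using r C0.partial_id_idem C1.partial_id_idem C0.partial_ids_closed by auto
  have mem: "(r, k) \<in> const_bundle X R" if "k \<in> carrier R" for k
    using that rX by (simp add: const_bundle_def)
  have "\<exists>d e. bundle_comp c R 0 (r, \<one>) (r, b) = Some d \<and> bundle_comp c R 0 (r, a) (r, \<one>) = Some e
      \<and> bundle_comp c R 1 d e = Some (r, a \<otimes> b)"
  proof (rule ex[unfolded usual_exchange_def, rule_format,
        OF _ _ mem[OF one_closed] mem[OF ab(1)] mem[OF ab(2)] mem[OF one_closed]])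
    show "(0::nat) < 1" "1 < n" using n by auto
    show "bundle_comp c R 1 (r, \<one>) (r, a) = Some (r, a)"
      using rr ab by (simp add: bundle_comp_Pair)
    show "bundle_comp c R 1 (r, b) (r, \<one>) = Some (r, b)"
      using rr ab by (simp add: bundle_comp_Pair)
    show "bundle_comp c R 0 (r, a) (r, b) = Some (r, a \<otimes> b)"
      using rr ab by (simp add: bundle_comp_Pair)
  qed
  then show ?thesis using rr ab by (simp add: bundle_comp_Pair)
qed

end

section \<open>The convolution algebra and the \<open>n\<close>-category of a constant bundle\<close>

theorem theorem5p24:
  fixes n :: nat
    and X :: "'x set"
    and c :: "nat \<Rightarrow> 'x \<Rightarrow> 'x \<Rightarrow> 'x option"
    and K :: "('k, 'm) ring_scheme"
    and A :: "('k, 'a, 'r) module_scheme"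
  assumes "finite X"
    and "strict_n_category n X c"
    and "unital_assoc_algebra K A"
  shows
    "(\<forall>p<n. \<exists>u. unital_assoc_algebra K (section_algebra X (c p) A u)) \<and>
     (\<forall>p u. embeds_bundle K X A (section_algebra X (c p) A u) (bundle_emb X A)) \<and>
     (\<forall>p<n. \<forall>v\<in>const_bundle X A. \<forall>w\<in>const_bundle X A. \<forall>t. bundle_comp c A p v w = Some t \<longrightarrow>
        convolution X (c p) A (bundle_emb X A v) (bundle_emb X A w) = bundle_emb X A t) \<and>
     strict_n_category n (const_bundle X A) (bundle_comp c A) \<and>
     ((\<exists>a\<in>carrier A. \<exists>b\<in>carrier A. a \<otimes>\<^bsub>A\<^esub> b \<noteq> b \<otimes>\<^bsub>A\<^esub> a) \<longrightarrow>
       (2 \<le> n \<and> X \<noteq> {} \<longrightarrow> \<not> usual_exchange n (const_bundle X A) (bundle_comp c A)) \<and>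
       noncommutative_exchange n (const_bundle X A) (bundle_comp c A))"
proof -
  interpret X: strict_n_category n X c by fact
  interpret A: unital_assoc_algebra K A by fact
  have algebra: "\<exists>u. unital_assoc_algebra K (section_algebra X (c p) A u)" if "p < n" for p
    using A.section_algebra_unital_assoc X.one_cat that assms(1) by blast
  have multiplicative:
    "convolution X (c p) A (bundle_emb X A v) (bundle_emb X A w) = bundle_emb X A t"
    if "v \<in> const_bundle X A" "w \<in> const_bundle X A" "bundle_comp c A p v w = Some t"
    for p v w t
    using that A.convolution_bundle_emb[OF assms(1)]
    by (auto simp: const_bundle_def bundle_comp_Pair)
  have commutes: "a \<otimes>\<^bsub>A\<^esub> b = b \<otimes>\<^bsub>A\<^esub> a"
    if "2 \<le> n \<and> X \<noteq> {}" "usual_exchange n (const_bundle X A) (bundle_comp c A)"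
      "a \<in> carrier A" "b \<in> carrier A" for a b
    using A.M.usual_exchange_bundle_commutes[OF assms(2)] that by blast
  show ?thesis
    using algebra A.bundle_embeds multiplicative A.M.strict_n_category_bundle[OF assms(2)]
      A.M.noncommutative_exchange_bundle[OF assms(2)] commutes
    by (intro conjI allI impI ballI notI) (assumption | blast)+
qed

end
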